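(* For all integers $t\ge2$ and $n\ge18t^6$, $f(n,t)\ge\frac{12}{5}t^3$.
   Context: All graphs are finite and simple. $\mathcal{G}_3(n)$ denotes the family of tripartite graphs with $n$ vertices in each of the three parts (each part is an independent set). $\delta(G)$ is the minimum degree of $G$ and $\tau(G)$ is the number of triangles in $G$. For integers $1\le t\le n$, \[ f(n,t)=\min\{\tau(G): G\in\mathcal{G}_3(n),\ \delta(G)\ge n+t\}. \] *)

theory Defs
  imports Complex_Main "Graph_Theory.Pair_Digraph"
begin

(* The locale pair_graph describes finite simple undirected graphs: a finite vertex set together
   with a symmetric and irreflexive set of ordered pairs on it, one edge uv being the two arcs
   (u, v) and (v, u).  Hence the degree of a vertex is its out-degree (= its in-degree).
   Since every finite graph is isomorphic to one on natural numbers and all quantities below are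
   isomorphism invariants, the extremal function ranges over graphs with vertices in nat. *)

definition independent_set :: "'a pair_pre_digraph \<Rightarrow> 'a set \<Rightarrow> bool" where
  "independent_set G S \<longleftrightarrow> S \<subseteq> pverts G \<and> (\<forall>u\<in>S. \<forall>v\<in>S. (u, v) \<notin> parcs G)"

definition tripartite_graphs :: "nat \<Rightarrow> 'a pair_pre_digraph set" where
  "tripartite_graphs n = {G. pair_graph G \<and>
     (\<exists>A B C. pverts G = A \<union> B \<union> C \<and> A \<inter> B = {} \<and> A \<inter> C = {} \<and> B \<inter> C = {} \<and>
        card A = n \<and> card B = n \<and> card C = n \<and>
        independent_set G A \<and> independent_set G B \<and> independent_set G C)}"

definition min_degree :: "'a pair_pre_digraph \<Rightarrow> nat" where
  "min_degree G = Min (out_degree (with_proj G) ` pverts G)"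

definition triangles :: "'a pair_pre_digraph \<Rightarrow> 'a set set" where
  "triangles G = {T. T \<subseteq> pverts G \<and> card T = 3 \<and>
     (\<forall>u\<in>T. \<forall>v\<in>T. u \<noteq> v \<longrightarrow> (u, v) \<in> parcs G)}"

definition num_triangles :: "'a pair_pre_digraph \<Rightarrow> nat" where
  "num_triangles G = card (triangles G)"

(* Inf of a nonempty set of natural numbers is its least element; for 1 <= t <= n the set is
   indeed nonempty, and the minimum is attained: see min_triangles_attained. *)
definition min_triangles :: "nat \<Rightarrow> nat \<Rightarrow> nat" where
  "min_triangles n t =
     Inf (num_triangles ` {G :: nat pair_pre_digraph. G \<in> tripartite_graphs n \<and> min_degree G \<ge> n + t})"

lemma tripartite_graphs_min_degree_nonempty:
  assumes "1 \<le> t" "t \<le> n"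
  shows "\<exists>G :: nat pair_pre_digraph. G \<in> tripartite_graphs n \<and> min_degree G \<ge> n + t"
proof -
  define G :: "nat pair_pre_digraph" where
    "G = \<lparr>pverts = {..<3*n}, parcs = {(u, v). u < 3*n \<and> v < 3*n \<and> u div n \<noteq> v div n}\<rparr>"
  define P where "P i = {i*n..<i*n+n}" for i
  have verts: "pverts G = {..<3*n}"
    and arcs: "(u, v) \<in> parcs G \<longleftrightarrow> u < 3*n \<and> v < 3*n \<and> u div n \<noteq> v div n" for u v
    by (simp_all add: G_def)
  have n: "n > 0" using assms by simp
  have divP: "u div n = i \<longleftrightarrow> u \<in> P i" for u i
    using n unfolding P_def by (simp add: div_nat_eqI dividend_less_div_times
        div_times_less_eq_dividend mult.commute) (metis add.commute div_nat_eqI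
        dividend_less_div_times div_times_less_eq_dividend mult.commute mult_Suc n)
  have sub: "P i \<subseteq> {..<3*n}" if "i < 3" for i
  proof -
    have "Suc i * n \<le> 3 * n" by (rule mult_le_mono1) (use that in simp)
    then have "i * n + n \<le> 3 * n" by simp
    then show ?thesis unfolding P_def subset_eq Ball_def atLeastLessThan_iff lessThan_iff
      by (meson order.strict_trans2)
  qed
  have cardP: "card (P i) = n" and finP: "finite (P i)" for i by (simp_all add: P_def)
  have "parcs G \<subseteq> {..<3*n} \<times> {..<3*n}" by (auto simp: arcs)
  then have "finite (parcs G)" by (rule finite_subset) simp
  moreover have "sym (parcs G)" by (rule symI) (auto simp: arcs)
  ultimately have "pair_graph G"
    by unfold_locales (simp_all add: verts arcs symmetric_def split_paired_all, blast)
  moreover have "pverts G = P 0 \<union> P 1 \<union> P 2" by (auto simp: verts P_def)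
  moreover have "P 0 \<inter> P 1 = {}" "P 0 \<inter> P 2 = {}" "P 1 \<inter> P 2 = {}" by (auto simp: P_def)
  moreover have "independent_set G (P i)" if "i < 3" for i
    using sub[OF that] by (simp add: independent_set_def verts arcs divP[symmetric])
  then have "independent_set G (P 0)" "independent_set G (P 1)" "independent_set G (P 2)"
    by simp_all
  ultimately have "G \<in> tripartite_graphs n"
    unfolding tripartite_graphs_def
    by (intro CollectI conjI exI[of _ "P 0"] exI[of _ "P 1"] exI[of _ "P 2"] cardP)
  moreover have "min_degree G \<ge> n + t"
  proof -
    have deg: "out_degree (with_proj G) v = 2 * n" if v: "v < 3 * n" for v
    proof -
      have i: "v div n < 3" using v n by (simp add: less_mult_imp_div_less)
      have "out_arcs (with_proj G) v = {v} \<times> ({..<3*n} - P (v div n))"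
      proof (rule set_eqI)
        fix e
        show "e \<in> out_arcs (with_proj G) v \<longleftrightarrow> e \<in> {v} \<times> ({..<3*n} - P (v div n))"
          using v by (cases e) (auto simp: out_arcs_def arcs divP[symmetric])
      qed
      then have "out_degree (with_proj G) v = card ({..<3*n} - P (v div n))"
        by (simp add: out_degree_def card_cartesian_product)
      also have "\<dots> = 2 * n" using sub[OF i] finP cardP by (simp add: card_Diff_subset)
      finally show ?thesis .
    qed
    have "out_degree (with_proj G) ` pverts G = {2 * n}"
    proof -
      have "out_degree (with_proj G) ` {..<3*n} = (\<lambda>_. 2 * n) ` {..<3*n}"
        by (rule image_cong) (simp_all add: deg)
      also have "\<dots> = {2 * n}" by (rule image_constant[of 0]) (use n in simp)
      finally show ?thesis by (simp add: verts)
    qed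
    then show ?thesis using assms by (simp add: min_degree_def)
  qed
  ultimately show ?thesis by blast
qed

lemma min_triangles_attained:
  assumes "1 \<le> t" "t \<le> n"
  shows "\<exists>G :: nat pair_pre_digraph. G \<in> tripartite_graphs n \<and> min_degree G \<ge> n + t \<and>
     num_triangles G = min_triangles n t"
proof -
  have "min_triangles n t \<in>
      num_triangles ` {G :: nat pair_pre_digraph. G \<in> tripartite_graphs n \<and> min_degree G \<ge> n + t}"
    unfolding min_triangles_def using tripartite_graphs_min_degree_nonempty[OF assms]
    by (intro Inf_nat_def1) blast
  then show ?thesis by auto
qed

end

(* Orient the parts cyclically. The deficit h(v) of a vertex v is its number of non-neighbours in the
   next part; then v has at least t + h(v) neighbours in the previous part, and an edge from u to a
   neighbour y in the previous part lies in at least t + h(y) - h(u) triangles. Let u have the least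
   deficit g among the sparse vertices, those in at most (4/5) t^2 triangles, and let P be the set of
   its at least t + g neighbours in the previous part. As u lies in few triangles, most y in P have
   h(y) well below g, hence are not sparse, or have h(y) small, hence lie in at least t^2 - h(y)^2
   triangles. Optimising gives at least (6/5) t^3 triangles meeting P. If there were fewer than
   (12/5) t^3 triangles in all, every vertex of these triangles would have few neighbours in the
   previous part, while its vertex in P would be joined to almost all of the next part. Since n is
   large, the triangles obtained from the opposite cyclic orientation are different ones. *)

theory Submission
  imports Defs
begin

section \<open>Notation and the optimisation over deficits\<close>

definition nbrs :: "'a pair_pre_digraph \<Rightarrow> 'a set \<Rightarrow> 'a \<Rightarrow> 'a set" where
  "nbrs G S v = {w \<in> S. (v, w) \<in> parcs G}"

definition triangles_at :: "'a pair_pre_digraph \<Rightarrow> 'a \<Rightarrow> 'a set set" where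
  "triangles_at G v = {T \<in> triangles G. v \<in> T}"

text \<open>All quantities are scaled: \<open>g\<close> and \<open>h y\<close> are the deficits of u
  and y divided by t, \<open>c y\<close> is the number of common neighbours of u and y divided by t,
  \<open>w y\<close> the number of triangles at y divided by t^2. A lower bound on \<open>w\<close>
  that is linear in \<open>c\<close> allows the budget \<open>sum_c\<close> to be subtracted for all
  of \<open>P\<close> at once.\<close>

lemma sum_ge_of_deficits:
  fixes c h w :: "'a \<Rightarrow> real" and g t :: real
  assumes "t > 0" and "g \<ge> 0" and card: "real (card P) \<ge> t * (1 + g)"
    and c: "\<And>y. y \<in> P \<Longrightarrow> c y \<ge> 0" "\<And>y. y \<in> P \<Longrightarrow> c y \<ge> 1 + h y - g"
    and sum_c: "sum c P \<le> 4 / 5 * t"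
    and h: "\<And>y. y \<in> P \<Longrightarrow> h y \<ge> 0"
    and w: "\<And>y. y \<in> P \<Longrightarrow> w y \<ge> 0" "\<And>y. y \<in> P \<Longrightarrow> w y \<ge> 1 - (h y)\<^sup>2"
      "\<And>y. y \<in> P \<Longrightarrow> h y < g \<Longrightarrow> w y \<ge> 4 / 5"
  shows "sum w P \<ge> 6 / 5 * t"
proof (cases "g \<le> 1")
  case True
  have w_ge: "w y \<ge> (2 - g) - c y" if y: "y \<in> P" for y
  proof -
    have "w y \<ge> 1 - h y"
    proof (cases "h y \<le> 1")
      case True
      then have "(h y)\<^sup>2 \<le> h y"
        using h[OF y] by (simp add: power2_eq_square mult_left_le)
      then show ?thesis using w(2)[OF y] by linarith
    next
      case False
      then show ?thesis using w(1)[OF y] by linarith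
    qed
    then show ?thesis using c(2)[OF y] by linarith
  qed
  \<comment> \<open>As (1 + g)(2 - g) = 2 + g(1 - g) >= 2, at least 2t - 4/5 t = 6/5 t
    remains.\<close>
  have "t * (1 + g) * (2 - g) \<le> real (card P) * (2 - g)"
    using card True by (intro mult_right_mono) auto
  moreover have "t * (1 + g) * (2 - g) - 2 * t = t * (g * (1 - g))"
    by (simp add: algebra_simps)
  moreover have "t * (g * (1 - g)) \<ge> 0"
    using True assms(1,2) by simp
  ultimately have "6 / 5 * t \<le> real (card P) * (2 - g) - sum c P"
    using sum_c by linarith
  also have "\<dots> = (\<Sum>y\<in>P. (2 - g) - c y)"
    by (simp add: sum_subtractf)
  also have "\<dots> \<le> sum w P"
    by (rule sum_mono) (rule w_ge)
  finally show ?thesis .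
next
  case False
  define q where "q = g - 1"
  have q: "q > 0" and g: "g = 1 + q" using False by (auto simp: q_def)
  \<comment> \<open>Each \<open>y\<close> starts with weight at least \<open>k\<close>, and one unit of \<open>c\<close> removes at most \<open>k\<close> of it. Sparsity
    alone gives \<open>k = 4 / 5\<close>, which suffices only for \<open>q \<ge> 3 / 10\<close>.\<close>
  define k where "k = (if q \<le> 3 / 10 then 1 - q\<^sup>2 else 4 / 5)"
  have q2: "q\<^sup>2 \<le> 3 / 10 * q" if "q \<le> 3 / 10"
    using mult_right_mono[OF that, of q] q by (simp add: power2_eq_square)
  have k: "k \<ge> 0" "k \<le> 1"
    using q2 by (auto simp: k_def)
  have w_ge: "w y \<ge> k * (1 - c y)" if y: "y \<in> P" for y
  proof (cases "h y < g")
    case False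
    then have "1 - c y \<le> 0" using c(2)[OF y] by linarith
    then have "k * (1 - c y) \<le> 0" using k by (simp add: mult_nonneg_nonpos)
    then show ?thesis using w(1)[OF y] by linarith
  next
    case True
    have w45: "w y \<ge> 4 / 5" by (rule w(3)[OF y True])
    \<comment> \<open>As \<open>k\<close> is at most 1, the bound \<open>w45\<close> suffices if
      \<open>c y\<close> is at least 1/5, and also if \<open>k\<close> is 4/5. Otherwise
      \<open>h y\<close> is at most \<open>q + c y\<close>, and the quadratic bound on
      \<open>w\<close> beats the linear one.\<close>
    show ?thesis
    proof (cases "q \<le> 3 / 10 \<and> c y < 1 / 5")
      case False
      have "k * (1 - c y) \<le> 4 / 5"
      proof (cases "q \<le> 3 / 10")
        case True
        then have "1 - c y \<le> 4 / 5" using False by auto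
        then have "k * (1 - c y) \<le> k * (4 / 5)" using k by (intro mult_left_mono)
        also have "\<dots> \<le> 4 / 5" using k by simp
        finally show ?thesis .
      next
        case False
        then show ?thesis using c(1)[OF y] by (simp add: k_def)
      qed
      then show ?thesis using w45 by linarith
    next
      case True
      have "h y \<le> q + c y" using c(2)[OF y] g by linarith
      then have "(h y)\<^sup>2 \<le> (q + c y)\<^sup>2"
        using h[OF y] by (intro power_mono)
      then have "w y \<ge> 1 - (q + c y)\<^sup>2" using w(2)[OF y] by linarith
      moreover have "1 - (q + c y)\<^sup>2 - k * (1 - c y) = c y * (1 - q\<^sup>2 - 2 * q - c y)"
        using True by (simp add: k_def power2_eq_square algebra_simps)
      moreover have "c y * (1 - q\<^sup>2 - 2 * q - c y) \<ge> 0"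
        using True q2 c(1)[OF y] by (intro mult_nonneg_nonneg) linarith+
      ultimately show ?thesis by linarith
    qed
  qed
  \<comment> \<open>In units of t, 6/5 + q = (1 + g) - 4/5 is the least size of \<open>P\<close>
    minus the budget of \<open>c\<close>.\<close>
  have "k * (6 / 5 + q) \<ge> 6 / 5"
  proof (cases "q \<le> 3 / 10")
    case True
    have "k * (6 / 5 + q) - 6 / 5 = q * (1 - 6 / 5 * q - q\<^sup>2)"
      using True by (simp add: k_def power2_eq_square field_simps)
    moreover have "\<dots> \<ge> 0"
      using True q q2 by (intro mult_nonneg_nonneg) linarith+
    ultimately show ?thesis by linarith
  next
    case False
    then show ?thesis by (simp add: k_def)
  qed
  then have "6 / 5 * t \<le> k * (6 / 5 + q) * t"
    using assms(1) by (intro mult_right_mono) auto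
  also have "\<dots> = k * (t * (1 + g) - 4 / 5 * t)"
    by (simp add: g algebra_simps)
  also have "\<dots> \<le> k * (real (card P) - sum c P)"
    using card sum_c k by (intro mult_left_mono) linarith+
  also have "\<dots> = (\<Sum>y\<in>P. k * (1 - c y))"
    by (simp add: sum_subtractf flip: sum_distrib_left)
  also have "\<dots> \<le> sum w P"
    by (rule sum_mono) (rule w_ge)
  finally show ?thesis .
qed

section \<open>Cyclically oriented tripartitions\<close>

text \<open>The index of a part is only relevant modulo 3, so that \<open>i + 2\<close> is the cyclic predecessor
  of \<open>i\<close>, and \<open>\<lambda>i. V (2 * i)\<close> is the opposite cyclic orientation.\<close>

locale cyclic_tripartition = pair_graph G for G :: "'a pair_pre_digraph" +
  fixes V :: "nat \<Rightarrow> 'a set" and n t :: nat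
  assumes period: "V (i + 3) = V i"
    and verts_eq: "pverts G = V i \<union> V (i + 1) \<union> V (i + 2)"
    and disjoint: "V i \<inter> V (i + 1) = {}"
    and indep: "independent_set G (V i)"
    and card_part: "card (V i) = n"
    and degree: "v \<in> V i \<Longrightarrow> n + t \<le> card (nbrs G (V (i + 1)) v) + card (nbrs G (V (i + 2)) v)"
begin

lemma period4: "V (i + 4) = V (i + 1)"
  using period[of "i + 1"] by (simp add: numeral_eq_Suc)

lemma part_mod: "V i = V (i mod 3)"
proof (induction i rule: less_induct)
  case (less i)
  show ?case
  proof (cases "i < 3")
    case False
    then show ?thesis using less[of "i - 3"] period[of "i - 3"] by (simp add: le_mod_geq)
  qed simp
qed

lemma finite_part: "finite (V i)"
  using verts_eq[of i] pair_finite_verts by simp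

lemma finite_nbrs [simp]: "finite (nbrs G (V i) v)"
  by (simp add: nbrs_def finite_part)

lemma disjoint2: "V i \<inter> V (i + 2) = {}"
  using disjoint[of "i + 2"] period[of i] by (auto simp: numeral_eq_Suc)

lemma disjoint12: "V (i + 1) \<inter> V (i + 2) = {}"
  using disjoint[of "i + 1"] by (simp add: numeral_eq_Suc)

lemma not_arc: "u \<in> V i \<Longrightarrow> v \<in> V i \<Longrightarrow> (u, v) \<notin> parcs G"
  using indep[of i] by (simp add: independent_set_def)

text \<open>Doubling fixes 0 and swaps 1 and 2 modulo 3, and the degree condition is symmetric in
  the two other parts. Hence every result holds with forward and backward exchanged.\<close>

lemma reverse: "cyclic_tripartition G (\<lambda>i. V (2 * i)) n t"
proof unfold_locales
  fix i v
  have p: "V (2 * (i + 1)) = V (2 * i + 2)" "V (2 * (i + 2)) = V (2 * i + 1)" "V (2 * (i + 3)) = V (2 * i)"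
    using period[of "2 * i + 1"] period[of "2 * i"] period[of "2 * i + 3"]
    by (simp_all add: numeral_eq_Suc)
  show "V (2 * (i + 3)) = V (2 * i)" by (rule p)
  show "pverts G = V (2 * i) \<union> V (2 * (i + 1)) \<union> V (2 * (i + 2))"
    unfolding p using verts_eq[of "2 * i"] by auto
  show "V (2 * i) \<inter> V (2 * (i + 1)) = {}"
    unfolding p by (rule disjoint2)
  show "independent_set G (V (2 * i))" by (rule indep)
  show "card (V (2 * i)) = n" by (rule card_part)
  show "n + t \<le> card (nbrs G (V (2 * (i + 1))) v) + card (nbrs G (V (2 * (i + 2))) v)"
    if "v \<in> V (2 * i)"
    unfolding p using degree[OF that] by simp
qed

section \<open>Deficits and triangle counts\<close>

definition deficit :: "nat \<Rightarrow> 'a \<Rightarrow> nat" where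
  "deficit i v = n - card (nbrs G (V (i + 1)) v)"

text \<open>By this bound the subtraction in \<open>deficit\<close> is never truncated.\<close>

lemma card_nbrs_le: "card (nbrs G (V i) v) \<le> n"
  unfolding card_part[of i, symmetric] by (rule card_mono[OF finite_part]) (auto simp: nbrs_def)

lemma deficit_le_card_nbrs:
  assumes "v \<in> V i"
  shows "t + deficit i v \<le> card (nbrs G (V (i + 2)) v)"
  using degree[OF assms] card_nbrs_le[of "i + 1" v] unfolding deficit_def by linarith

lemma deficit_le_card_nbrs':
  assumes "y \<in> V (i + 2)"
  shows "t + deficit (i + 2) y \<le> card (nbrs G (V (i + 1)) y)"
  using deficit_le_card_nbrs[OF assms] period4[of i] by (simp add: numeral_eq_Suc)

text \<open>Only \<open>deficit i u\<close> vertices of part \<open>i + 1\<close> are missed by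
  \<open>u\<close>. For adjacent \<open>u\<close> and \<open>y\<close> this bounds from below the
  triangles on the edge uy.\<close>

lemma card_common_nbrs:
  "card (nbrs G (V (i + 1)) y)
    \<le> card (nbrs G (V (i + 1)) u \<inter> nbrs G (V (i + 1)) y) + deficit i u"
proof -
  let ?A = "nbrs G (V (i + 1)) u" and ?B = "nbrs G (V (i + 1)) y"
  have "card ?A + card ?B = card (?A \<union> ?B) + card (?A \<inter> ?B)"
    by (rule card_Un_Int) simp_all
  moreover have "card (?A \<union> ?B) \<le> n"
    unfolding card_part[of "i + 1", symmetric]
    by (rule card_mono[OF finite_part]) (auto simp: nbrs_def)
  ultimately show ?thesis
    using card_nbrs_le[of "i + 1" u] by (simp add: deficit_def)
qed

lemma finite_triangles: "finite (triangles G)"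
  by (rule finite_subset[of _ "Pow (pverts G)"]) (auto simp: triangles_def pair_finite_verts)

lemma finite_triangles_at [simp]: "finite (triangles_at G v)"
  by (simp add: triangles_at_def finite_triangles)

lemma card_triangles_at_le: "card (triangles_at G v) \<le> num_triangles G"
  unfolding num_triangles_def triangles_at_def by (rule card_mono[OF finite_triangles]) auto

text \<open>The parts are disjoint, so the set {u, y, w} determines y and w, and no triangle is
  counted twice.\<close>

lemma sum_common_nbrs_le:
  assumes u: "u \<in> V i"
  shows "(\<Sum>y\<in>nbrs G (V (i + 2)) u. card (nbrs G (V (i + 1)) u \<inter> nbrs G (V (i + 1)) y))
    \<le> card (triangles_at G u)"
proof -
  let ?C = "\<lambda>y. nbrs G (V (i + 1)) u \<inter> nbrs G (V (i + 1)) y"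
  let ?S = "SIGMA y:nbrs G (V (i + 2)) u. ?C y"
  have "(\<Sum>y\<in>nbrs G (V (i + 2)) u. card (?C y)) = card ?S" by simp
  also have "\<dots> \<le> card (triangles_at G u)"
  proof (rule card_inj_on_le[where f = "\<lambda>(y, w). {u, y, w}"])
    have "y = y' \<and> w = w'"
      if "{u, y, w} = {u, y', w'}" "y \<in> V (i + 2)" "y' \<in> V (i + 2)" "w \<in> V (i + 1)" "w' \<in> V (i + 1)"
      for y w y' w'
    proof -
      have "y \<in> {u, y', w'}" "w \<in> {u, y', w'}" using that(1) by blast+
      moreover have "y \<noteq> u" "w \<noteq> u" "y \<noteq> w'" "w \<noteq> y'"
        using that(2-5) u disjoint[of i] disjoint2[of i] disjoint12[of i] by auto
      ultimately show ?thesis by simp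
    qed
    then show "inj_on (\<lambda>(y, w). {u, y, w}) ?S"
      unfolding inj_on_def by (auto simp: nbrs_def)
    have "{u, y, w} \<in> triangles_at G u" if "(u, y) \<in> parcs G" "(u, w) \<in> parcs G" "(y, w) \<in> parcs G" for y w
      using that no_loops' arcs_symmetric wellformed'
      by (auto simp: triangles_at_def triangles_def card_insert_if)
    then show "(\<lambda>(y, w). {u, y, w}) ` ?S \<subseteq> triangles_at G u"
      by (auto simp: nbrs_def)
  qed simp
  finally show ?thesis .
qed

text \<open>A triangle meets an independent part in at most one vertex.\<close>

lemma card_UN_triangles_at:
  assumes "P \<subseteq> V i"
  shows "card (\<Union>y\<in>P. triangles_at G y) = (\<Sum>y\<in>P. card (triangles_at G y))"
proof (rule card_UN_disjoint)
  show "finite P" using assms finite_part by (rule finite_subset)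
  show "\<forall>y\<in>P. finite (triangles_at G y)" by simp
  show "\<forall>y\<in>P. \<forall>z\<in>P. y \<noteq> z \<longrightarrow> triangles_at G y \<inter> triangles_at G z = {}"
    using assms not_arc[of _ i] unfolding triangles_at_def triangles_def by blast
qed

lemma sum_triangles_at_le:
  assumes "P \<subseteq> V i"
  shows "(\<Sum>y\<in>P. card (triangles_at G y)) \<le> num_triangles G"
  unfolding card_UN_triangles_at[OF assms, symmetric] num_triangles_def
  by (rule card_mono[OF finite_triangles]) (auto simp: triangles_at_def)

text \<open>If \<open>v\<close> has deficit d <= t, it has at least t + d backward neighbours, and
  the edge to each of them lies in at least t - d triangles.\<close>

lemma triangles_at_ge:
  assumes v: "v \<in> V i"
  shows "real (card (triangles_at G v)) \<ge> (real t)\<^sup>2 - (real (deficit i v))\<^sup>2"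
proof (cases "deficit i v \<le> t")
  case True
  let ?d = "deficit i v" and ?P = "nbrs G (V (i + 2)) v"
  have common: "card (nbrs G (V (i + 1)) v \<inter> nbrs G (V (i + 1)) y) \<ge> t - ?d" if "y \<in> ?P" for y
    using card_common_nbrs[of i y v] deficit_le_card_nbrs'[of y i] that by (auto simp: nbrs_def)
  have "(t + ?d) * (t - ?d) \<le> card ?P * (t - ?d)"
    using deficit_le_card_nbrs[OF v] by (intro mult_right_mono) auto
  also have "\<dots> \<le> (\<Sum>y\<in>?P. card (nbrs G (V (i + 1)) v \<inter> nbrs G (V (i + 1)) y))"
    using sum_bounded_below[of ?P "t - ?d"] common by simp
  also have "\<dots> \<le> card (triangles_at G v)"
    by (rule sum_common_nbrs_le[OF v])
  finally have "real ((t + ?d) * (t - ?d)) \<le> real (card (triangles_at G v))" by linarith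
  moreover have "real ((t + ?d) * (t - ?d)) = (real t)\<^sup>2 - (real ?d)\<^sup>2"
    unfolding of_nat_mult of_nat_add of_nat_diff[OF True] by (simp add: power2_eq_square algebra_simps)
  ultimately show ?thesis by linarith
next
  case False
  then have "(real t)\<^sup>2 \<le> (real (deficit i v))\<^sup>2" by (intro power_mono) auto
  then show ?thesis by (smt (verit) of_nat_0_le_iff)
qed

section \<open>Sparse vertices\<close>

definition sparse :: "'a \<Rightarrow> bool" where
  "sparse v \<longleftrightarrow> real (card (triangles_at G v)) \<le> 4 / 5 * (real t)\<^sup>2"

text \<open>Minimality of \<open>u\<close> ranges over all parts, so a backward neighbour of smaller
  deficit is not sparse. After scaling, this is an instance of
  \<open>sum_ge_of_deficits\<close>.\<close>

lemma sum_triangles_at_ge: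
  assumes u: "u \<in> V i" "sparse u" and t: "t > 0"
    and least: "\<And>j v. v \<in> V j \<Longrightarrow> sparse v \<Longrightarrow> deficit i u \<le> deficit j v"
  shows "real (\<Sum>y\<in>nbrs G (V (i + 2)) u. card (triangles_at G y)) \<ge> 6 / 5 * real t ^ 3"
proof -
  let ?P = "nbrs G (V (i + 2)) u" and ?g = "deficit i u"
  let ?C = "\<lambda>y. card (nbrs G (V (i + 1)) u \<inter> nbrs G (V (i + 1)) y)"
  have "(\<Sum>y\<in>?P. real (card (triangles_at G y)) / (real t)\<^sup>2) \<ge> 6 / 5 * real t"
  proof (rule sum_ge_of_deficits[where g = "?g / t" and c = "\<lambda>y. ?C y / t"
        and h = "\<lambda>y. deficit (i + 2) y / t"])
    have "real t * (1 + ?g / t) = t + ?g" using t by (simp add: field_simps)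
    then show "real t * (1 + ?g / t) \<le> card ?P"
      using deficit_le_card_nbrs[OF u(1)] by linarith
    have "real (\<Sum>y\<in>?P. ?C y) \<le> 4 / 5 * (real t)\<^sup>2"
      using sum_common_nbrs_le[OF u(1)] u(2) unfolding sparse_def by linarith
    then show "(\<Sum>y\<in>?P. ?C y / real t) \<le> 4 / 5 * real t"
      using t by (simp add: field_simps power2_eq_square flip: sum_divide_distrib)
  next
    fix y assume "y \<in> ?P"
    then have y: "y \<in> V (i + 2)" by (simp add: nbrs_def)
    have "t + deficit (i + 2) y \<le> ?C y + ?g"
      using card_common_nbrs[of i y u] deficit_le_card_nbrs'[OF y] by linarith
    then have "(real t + real (deficit (i + 2) y) - ?g) / t \<le> ?C y / t"
      by (intro divide_right_mono) linarith+
    then show "1 + deficit (i + 2) y / real t - ?g / t \<le> ?C y / real t"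
      using t by (simp add: add_divide_distrib diff_divide_distrib)
    show "1 - (deficit (i + 2) y / real t)\<^sup>2 \<le> real (card (triangles_at G y)) / (real t)\<^sup>2"
      using divide_right_mono[OF triangles_at_ge[OF y], of "(real t)\<^sup>2"] t
      by (simp add: diff_divide_distrib power_divide)
    show "4 / 5 \<le> real (card (triangles_at G y)) / (real t)\<^sup>2"
      if "deficit (i + 2) y / real t < ?g / t"
    proof -
      have "\<not> sparse y" using least[OF y] that t by (auto simp: divide_less_cancel)
      then show ?thesis using t by (simp add: sparse_def field_simps)
    qed
  qed (use t in auto)
  then have "6 / 5 * real t \<le> real (\<Sum>y\<in>?P. card (triangles_at G y)) / (real t)\<^sup>2"
    by (simp flip: sum_divide_distrib)
  then show ?thesis
    using t by (simp add: field_simps power2_eq_square power3_eq_cube)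
qed

text \<open>Different vertices of one part lie in different triangles, more than 4/5 t^2 for each
  vertex counted here. The 3 is 12/5 divided by 4/5.\<close>

lemma card_not_sparse:
  assumes "t > 0" and few: "real (num_triangles G) < 12 / 5 * real t ^ 3"
  shows "card {v \<in> V i. \<not> sparse v} < 3 * t"
proof -
  let ?X = "{v \<in> V i. \<not> sparse v}"
  have "real (card ?X) * (4 / 5 * (real t)\<^sup>2) \<le> (\<Sum>v\<in>?X. real (card (triangles_at G v)))"
    by (rule sum_bounded_below) (simp add: sparse_def)
  also have "\<dots> \<le> num_triangles G"
    using sum_triangles_at_le[of ?X i] by (simp flip: of_nat_sum)
  also have "\<dots> < 3 * t * (4 / 5 * (real t)\<^sup>2)"
    using few by (simp add: power2_eq_square power3_eq_cube)
  finally show ?thesis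
    using assms(1) by (simp add: mult_less_cancel_right)
qed

text \<open>For a sparse backward neighbour y, whose deficit is at least that of \<open>u\<close>,
  the edge uy lies in at least t triangles; as \<open>u\<close> is sparse, there are at most 4/5 t
  such y. With fewer than 3t others, this limits the at least t + \<open>deficit i u\<close>
  backward neighbours.\<close>

lemma least_deficit_le:
  assumes u: "u \<in> V i" "sparse u" and t: "t > 0"
    and least: "\<And>j v. v \<in> V j \<Longrightarrow> sparse v \<Longrightarrow> deficit i u \<le> deficit j v"
    and few: "real (num_triangles G) < 12 / 5 * real t ^ 3"
  shows "deficit i u < 3 * t"
proof -
  let ?P = "nbrs G (V (i + 2)) u"
  let ?S = "{y \<in> ?P. sparse y}" and ?X = "{y \<in> V (i + 2). \<not> sparse y}"
  let ?C = "\<lambda>y. card (nbrs G (V (i + 1)) u \<inter> nbrs G (V (i + 1)) y)"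
  have common: "t \<le> ?C y" if "y \<in> ?S" for y
  proof -
    have y: "y \<in> V (i + 2)" "sparse y" using that by (auto simp: nbrs_def)
    show ?thesis
      using card_common_nbrs[of i y u] deficit_le_card_nbrs'[OF y(1)] least[OF y] by linarith
  qed
  have "card ?S * t \<le> (\<Sum>y\<in>?S. ?C y)"
    using sum_bounded_below[of ?S t ?C] common by simp
  also have "\<dots> \<le> (\<Sum>y\<in>?P. ?C y)"
    by (rule sum_mono2) auto
  also have "\<dots> \<le> card (triangles_at G u)"
    by (rule sum_common_nbrs_le[OF u(1)])
  finally have "real (card ?S * t) \<le> real (card (triangles_at G u))" by (rule of_nat_mono)
  then have "real (card ?S * t) \<le> 4 / 5 * (real t)\<^sup>2" using u(2) unfolding sparse_def by linarith
  then have "real (card ?S) \<le> 4 / 5 * t" using t by (simp add: power2_eq_square)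
  moreover have "card ?P \<le> card ?S + card ?X"
  proof -
    have "card ?P \<le> card (?S \<union> ?X)"
      by (rule card_mono) (auto simp: nbrs_def finite_part)
    also have "\<dots> \<le> card ?S + card ?X" by (rule card_Un_le)
    finally show ?thesis .
  qed
  ultimately show ?thesis
    using card_not_sparse[OF t few, of "i + 2"] deficit_le_card_nbrs[OF u(1)] by linarith
qed

section \<open>Backward degrees and the triangle family\<close>

lemma backward_nbrs_le:
  assumes u: "u \<in> V i" and y: "y \<in> nbrs G (V (i + 2)) u"
  shows "card (nbrs G (V (i + 1)) y) \<le> num_triangles G + deficit i u"
proof -
  let ?C = "\<lambda>y. card (nbrs G (V (i + 1)) u \<inter> nbrs G (V (i + 1)) y)"
  \<comment> \<open>Each common neighbour of \<open>u\<close> and \<open>y\<close> completes a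
    triangle, so few triangles mean few common neighbours.\<close>
  have "?C y \<le> (\<Sum>y\<in>nbrs G (V (i + 2)) u. ?C y)"
    by (rule member_le_sum[OF y]) auto
  then have "?C y \<le> num_triangles G"
    using sum_common_nbrs_le[OF u] card_triangles_at_le[of u] by linarith
  then show ?thesis using card_common_nbrs[of i y u] by linarith
qed

text \<open>Walking backwards, each step increases the backward degree by at most the number of
  triangles, and every vertex of a triangle through \<open>y\<close> is reached from \<open>u\<close> in at most three steps.\<close>

lemma triangle_backward_nbrs_le:
  assumes u: "u \<in> V i" and y: "y \<in> nbrs G (V (i + 2)) u"
    and T: "T \<in> triangles G" "y \<in> T" and v: "v \<in> T" "v \<in> V j"
  shows "card (nbrs G (V (j + 2)) v) \<le> 3 * num_triangles G + deficit i u"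
proof -
  have y': "y \<in> V (i + 2)" using y by (simp add: nbrs_def)
  \<comment> \<open>The deficit of \<open>x\<close> is replaced by its backward degree, which is at
    least as large, so that the bound can be iterated.\<close>
  have step: "card (nbrs G (V (k + 1)) w) \<le> num_triangles G + card (nbrs G (V (k + 2)) x)"
    if "x \<in> V k" "w \<in> V (k + 2)" "(x, w) \<in> parcs G" for x w k
    using backward_nbrs_le[OF that(1), of w] deficit_le_card_nbrs[OF that(1)] that
    by (simp add: nbrs_def)
  have by': "card (nbrs G (V (i + 1)) y) \<le> num_triangles G + deficit i u"
    by (rule backward_nbrs_le[OF u y])
  have arc: "(a, b) \<in> parcs G" if "a \<in> T" "b \<in> T" "a \<noteq> b" for a b
    using T(1) that by (auto simp: triangles_def)
  have v2: "card (nbrs G (V (i + 1)) v) \<le> num_triangles G + deficit i u" if "v \<in> V (i + 2)"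
    using not_arc[OF y' that] arc[OF T(2) v(1)] by' by auto
  have v1: "card (nbrs G (V i) w) \<le> 2 * num_triangles G + deficit i u"
    if "w \<in> V (i + 1)" "w \<in> T" for w
  proof -
    have "(y, w) \<in> parcs G" using that y' disjoint12[of i] arc[OF T(2)] by auto
    then show ?thesis
      using step[of y "i + 2" w] that y' by' period4[of i] period[of i] by (simp add: numeral_eq_Suc)
  qed
  \<comment> \<open>Part \<open>i\<close> is two backward steps from part \<open>i + 2\<close>, so
    \<open>v\<close> is reached through the third vertex of \<open>T\<close>, in part
    \<open>i + 1\<close>.\<close>
  have v0: "card (nbrs G (V (i + 2)) v) \<le> 3 * num_triangles G + deficit i u" if v0: "v \<in> V i"
  proof -
    have yv: "y \<noteq> v" using y' v0 disjoint2[of i] by auto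
    have "\<not> T \<subseteq> {y, v}"
      using card_mono[of "{y, v}" T] T(1) yv by (auto simp: triangles_def)
    then obtain w where w: "w \<in> T" "w \<noteq> y" "w \<noteq> v" by auto
    have "w \<in> V (i + 1)"
      using T(1) w verts_eq[of i] arc[OF w(1) v(1)] arc[OF w(1) T(2)] not_arc[OF _ v0] not_arc[OF _ y']
      by (auto simp: triangles_def)
    moreover have "(w, v) \<in> parcs G" using w arc v(1) by auto
    ultimately show ?thesis
      using v1[of w] w(1) v0 step[of w "i + 1" v] period[of i] by (simp add: numeral_eq_Suc)
  qed
  have cong: "V k = V l" if "k mod 3 = l mod 3" for k l
    using part_mod[of k] part_mod[of l] that by simp
  have "j mod 3 = i mod 3 \<or> j mod 3 = (i + 1) mod 3 \<or> j mod 3 = (i + 2) mod 3"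
    using mod_less_divisor[of 3 i] mod_less_divisor[of 3 j] by (simp add: mod_Suc) linarith
  then consider "j mod 3 = i mod 3" | "j mod 3 = (i + 1) mod 3" | "j mod 3 = (i + 2) mod 3"
    by blast
  then show ?thesis
  proof cases
    case 1
    then have "(j + 2) mod 3 = (i + 2) mod 3"
      by (simp add: mod_Suc split: if_splits)
    with 1 have "V j = V i" "V (j + 2) = V (i + 2)" by - (rule cong, assumption)+
    then show ?thesis using v0 v(2) by simp
  next
    case 2
    then have "(j + 2) mod 3 = i mod 3"
      using mod_less_divisor[of 3 i] by (simp add: mod_Suc split: if_splits) linarith
    with 2 have "V j = V (i + 1)" "V (j + 2) = V i" by - (rule cong, assumption)+
    then show ?thesis using v1[of v] v by simp
  next
    case 3
    then have "(j + 2) mod 3 = (i + 1) mod 3"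
      using mod_less_divisor[of 3 i] by (simp add: mod_Suc split: if_splits)
    with 3 have "V j = V (i + 2)" "V (j + 2) = V (i + 1)" by - (rule cong, assumption)+
    then show ?thesis using v2 v(2) by simp
  qed
qed

text \<open>The last two properties set small backward degrees at all vertices of a member against a
  nearly full forward degree at one of them. Reversing the orientation swaps the two, which
  separates the families of opposite orientations when n is large.\<close>

lemma exists_triangle_family:
  assumes t: "t > 0" and n: "3 * t \<le> n" and few: "real (num_triangles G) < 12 / 5 * real t ^ 3"
  obtains F where "F \<subseteq> triangles G" "real (card F) \<ge> 6 / 5 * real t ^ 3"
    "\<And>T j v. T \<in> F \<Longrightarrow> v \<in> T \<Longrightarrow> v \<in> V j \<Longrightarrow>
      card (nbrs G (V (j + 2)) v) \<le> 3 * num_triangles G + 3 * t"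
    "\<And>T. T \<in> F \<Longrightarrow> \<exists>j. \<exists>v\<in>T \<inter> V j.
      n \<le> card (nbrs G (V (j + 1)) v) + num_triangles G + 3 * t"
proof -
  let ?X = "{v \<in> V 0. \<not> sparse v}"
  have "card ?X < card (V 0)"
    using card_not_sparse[OF t few, of 0] n card_part[of 0] by linarith
  then have "?X \<noteq> V 0" by auto
  then obtain v0 where "v0 \<in> V 0" "sparse v0" by auto
  \<comment> \<open>Minimising over pairs of a part index and a vertex compares sparse vertices of
    all parts at once.\<close>
  then obtain p where p: "snd p \<in> V (fst p) \<and> sparse (snd p)"
    and p_least: "\<forall>q. snd q \<in> V (fst q) \<and> sparse (snd q) \<longrightarrow>
      deficit (fst p) (snd p) \<le> deficit (fst q) (snd q)"
    using ex_has_least_nat[of "\<lambda>p. snd p \<in> V (fst p) \<and> sparse (snd p)" "(0, v0)"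
        "\<lambda>p. deficit (fst p) (snd p)"] by auto
  obtain i u where iu: "p = (i, u)" by (cases p)
  have u: "u \<in> V i" "sparse u" using p iu by auto
  have least: "deficit i u \<le> deficit j v" if "v \<in> V j" "sparse v" for j v
    using p_least[rule_format, of "(j, v)"] that iu by simp
  have small: "deficit i u < 3 * t"
    by (rule least_deficit_le[OF u t least few])
  let ?P = "nbrs G (V (i + 2)) u"
  let ?F = "\<Union>y\<in>?P. triangles_at G y"
  have P: "?P \<subseteq> V (i + 2)" by (auto simp: nbrs_def)
  show thesis
  proof
    show "?F \<subseteq> triangles G" by (auto simp: triangles_at_def)
    show "real (card ?F) \<ge> 6 / 5 * real t ^ 3"
      unfolding card_UN_triangles_at[OF P] by (rule sum_triangles_at_ge[OF u t least])
    show "card (nbrs G (V (j + 2)) v) \<le> 3 * num_triangles G + 3 * t"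
      if T: "T \<in> ?F" "v \<in> T" "v \<in> V j" for T j v
    proof -
      obtain y where "y \<in> ?P" "T \<in> triangles G" "y \<in> T"
        using T(1) by (auto simp: triangles_at_def)
      from triangle_backward_nbrs_le[OF u(1) this T(2,3)] show ?thesis using small by linarith
    qed
    show "\<exists>j. \<exists>v\<in>T \<inter> V j. n \<le> card (nbrs G (V (j + 1)) v) + num_triangles G + 3 * t"
      if T: "T \<in> ?F" for T
    proof -
      obtain y where y: "y \<in> ?P" "y \<in> T"
        using T by (auto simp: triangles_at_def)
      then have y2: "y \<in> V (i + 2)" by (auto simp: nbrs_def)
      \<comment> \<open>The deficit of \<open>y\<close> is at most its backward degree, hence at
        most the number of triangles plus 3t.\<close>
      have "n \<le> card (nbrs G (V (i + 2 + 1)) y) + num_triangles G + 3 * t"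
        using backward_nbrs_le[OF u(1) y(1)] deficit_le_card_nbrs'[OF y2] small
        unfolding deficit_def by linarith
      then show ?thesis using y(2) y2 by blast
    qed
  qed
qed

lemma num_triangles_ge:
  assumes t: "t > 0" and n: "n \<ge> 18 * t ^ 6"
  shows "real (num_triangles G) \<ge> 12 / 5 * real t ^ 3"
proof (rule ccontr)
  assume "\<not> ?thesis"
  then have few: "real (num_triangles G) < 12 / 5 * real t ^ 3" by simp
  \<comment> \<open>With T triangles in all, 4T + 6t < 48/5 t^3 + 6t^3 = 78/5 t^3 <= 18t^3 <=
    n.\<close>
  have "t ^ 3 \<le> t ^ 6" "t ^ 1 \<le> t ^ 3" using t by (intro power_increasing; simp)+
  then have "18 * t ^ 3 \<le> n" "t \<le> t ^ 3" using n by simp_all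
  then have "18 * real t ^ 3 \<le> real n" "real t \<le> real t ^ 3"
    using of_nat_mono[of "18 * t ^ 3" n, where ?'a = real] of_nat_mono[of t "t ^ 3", where ?'a = real]
    by simp_all
  then have "real (4 * num_triangles G + 6 * t) < real n" "real (3 * t) \<le> real n"
    using few zero_le_power[of "real t" 3] unfolding of_nat_add of_nat_mult of_nat_numeral
    by linarith+
  then have big: "4 * num_triangles G + 6 * t < n" and n3: "3 * t \<le> n" by linarith+
  interpret rev: cyclic_tripartition G "\<lambda>i. V (2 * i)" n t by (rule reverse)
  obtain F where F: "F \<subseteq> triangles G" "real (card F) \<ge> 6 / 5 * real t ^ 3"
    and F_bwd: "\<And>T j v. T \<in> F \<Longrightarrow> v \<in> T \<Longrightarrow> v \<in> V j \<Longrightarrow>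
      card (nbrs G (V (j + 2)) v) \<le> 3 * num_triangles G + 3 * t"
    using exists_triangle_family[OF t n3 few] by metis
  obtain F' where F': "F' \<subseteq> triangles G" "real (card F') \<ge> 6 / 5 * real t ^ 3"
    and F'_fwd: "\<And>T. T \<in> F' \<Longrightarrow> \<exists>j. \<exists>v\<in>T \<inter> V (2 * j).
      n \<le> card (nbrs G (V (2 * (j + 1))) v) + num_triangles G + 3 * t"
    using rev.exists_triangle_family[OF t n3 few] by metis
  \<comment> \<open>The part after \<open>V (2 * j)\<close> in the reversed orientation is
    \<open>V (2 * j + 2)\<close>, the part before it in the original one. A common triangle would
    thus give n <= 4T + 6t, where T is the number of triangles.\<close>
  have "F \<inter> F' = {}"
  proof (rule ccontr)
    assume "F \<inter> F' \<noteq> {}"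
    then obtain T where T: "T \<in> F" "T \<in> F'" by blast
    from F'_fwd[OF T(2)] obtain j v where v: "v \<in> T" "v \<in> V (2 * j)"
      and "n \<le> card (nbrs G (V (2 * j + 2)) v) + num_triangles G + 3 * t" by auto
    then show False using F_bwd[OF T(1) v] big by linarith
  qed
  then have "card F + card F' = card (F \<union> F')"
    using F(1) F'(1) finite_triangles by (intro card_Un_disjoint[symmetric]) (auto intro: finite_subset)
  also have "\<dots> \<le> num_triangles G"
    unfolding num_triangles_def using F(1) F'(1) by (intro card_mono finite_triangles) auto
  finally show False using F(2) F'(2) few by linarith
qed

end

section \<open>From tripartite graphs to oriented tripartitions\<close>

lemma out_degree_le_nbrs:
  assumes G: "pair_graph G" and v: "v \<in> X" and verts: "pverts G = X \<union> Y \<union> Z" and X: "independent_set G X"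
  shows "out_degree (with_proj G) v \<le> card (nbrs G Y v) + card (nbrs G Z v)"
proof -
  interpret pair_graph G by (rule G)
  have "out_arcs (with_proj G) v \<subseteq> Pair v ` (nbrs G Y v \<union> nbrs G Z v)"
  proof
    fix e assume "e \<in> out_arcs (with_proj G) v"
    then obtain w where e: "e = (v, w)" and vw: "(v, w) \<in> parcs G"
      by (cases e) (auto simp: out_arcs_def)
    have "w \<notin> X" using v vw X unfolding independent_set_def by blast
    then have "w \<in> Y \<union> Z" using in_arcsD2[OF vw] verts by blast
    then show "e \<in> Pair v ` (nbrs G Y v \<union> nbrs G Z v)" using e vw by (auto simp: nbrs_def)
  qed
  moreover have fin: "finite (nbrs G Y v \<union> nbrs G Z v)"
    using pair_finite_verts verts by (auto simp: nbrs_def)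
  ultimately have "out_degree (with_proj G) v \<le> card (nbrs G Y v \<union> nbrs G Z v)"
    unfolding out_degree_def by (meson card_image_le card_mono finite_imageI le_trans)
  also have "\<dots> \<le> card (nbrs G Y v) + card (nbrs G Z v)" by (rule card_Un_le)
  finally show ?thesis .
qed

lemma cyclic_tripartition_of_tripartite_graph:
  assumes "G \<in> tripartite_graphs n" and deg: "min_degree G \<ge> n + t"
  obtains V where "cyclic_tripartition G V n t"
proof -
  from assms(1) obtain A B C where G: "pair_graph G" and verts: "pverts G = A \<union> B \<union> C"
    and disj: "A \<inter> B = {}" "A \<inter> C = {}" "B \<inter> C = {}"
    and card: "card A = n" "card B = n" "card C = n"
    and ind: "independent_set G A" "independent_set G B" "independent_set G C"
    unfolding tripartite_graphs_def by blast
  interpret pair_graph G by (rule G)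
  have deg_ge: "n + t \<le> out_degree (with_proj G) v" if "v \<in> pverts G" for v
    using deg Min_le[of "out_degree (with_proj G) ` pverts G" "out_degree (with_proj G) v"]
      that pair_finite_verts unfolding min_degree_def by (meson finite_imageI imageI le_trans)
  define V where "V i = (if i mod 3 = 0 then A else if i mod 3 = 1 then B else C)" for i :: nat
  have shift: "V i = A \<and> V (i + 1) = B \<and> V (i + 2) = C \<or> V i = B \<and> V (i + 1) = C \<and> V (i + 2) = A \<or>
    V i = C \<and> V (i + 1) = A \<and> V (i + 2) = B" for i
  proof -
    have "i mod 3 = 0 \<or> i mod 3 = 1 \<or> i mod 3 = 2"
      using mod_less_divisor[of 3 i] by linarith
    then show ?thesis by (auto simp: V_def mod_Suc)
  qed
  have "cyclic_tripartition G V n t"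
  proof unfold_locales
    fix i v
    show "V (i + 3) = V i" by (simp add: V_def)
    show vi: "pverts G = V i \<union> V (i + 1) \<union> V (i + 2)" using shift[of i] verts by auto
    show "V i \<inter> V (i + 1) = {}" using shift[of i] disj by auto
    show indi: "independent_set G (V i)" using shift[of i] ind by auto
    show "card (V i) = n" using shift[of i] card by auto
    show "n + t \<le> card (nbrs G (V (i + 1)) v) + card (nbrs G (V (i + 2)) v)" if "v \<in> V i"
      using out_degree_le_nbrs[OF G that vi indi] deg_ge[of v] that vi by auto
  qed
  then show thesis by (rule that)
qed

theorem theorem1p4:
  fixes n t :: nat
  assumes "t \<ge> 2" and "n \<ge> 18 * t ^ 6"
  shows "real (min_triangles n t) \<ge> 12 / 5 * real t ^ 3"
proof -
  have "t ^ 1 \<le> t ^ 6" using assms(1) by (intro power_increasing) auto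
  then have "1 \<le> t" "t \<le> n" using assms by simp_all
  then obtain G :: "nat pair_pre_digraph" where G: "G \<in> tripartite_graphs n" "min_degree G \<ge> n + t"
    and "num_triangles G = min_triangles n t"
    using min_triangles_attained by blast
  moreover obtain V where "cyclic_tripartition G V n t"
    using cyclic_tripartition_of_tripartite_graph[OF G] .
  then have "real (num_triangles G) \<ge> 12 / 5 * real t ^ 3"
    by (rule cyclic_tripartition.num_triangles_ge) (use assms in auto)
  ultimately show ?thesis by simp
qed

end
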